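(* For every $\eta>0$ there is a constant $c_0$ such that for every integer constant $c\ge c_0$ there is a constant $C$ (depending only on $c$) for which the following holds for every $k\ge 2$. If $k$ stations execute the protocol NonAdaptiveWithK$(k,c)$ and are activated by any adaptive adversary, then with probability at least $1-1/k^{\eta}$ every station transmits successfully within $Ck$ rounds after its own activation.
   Context: Model. $k$ anonymous identical stations share a channel. Time is divided into discrete synchronous rounds; there is no global clock available to the stations and no collision detection. Initially all stations are asleep. Each station holds one packet and is activated once, at a time chosen by an adversary. The activation round is round $0$ of the station's local clock, and the station may transmit from its local round $1$ on. In each round every active station either transmits or listens. A transmission is successful if and only if exactly one active station transmits in that round; the transmitter then receives an acknowledgement. In all other cases (silence or collision, which are indistinguishable to listeners) nothing is received. The algorithm is non-adaptive: transmission decisions depend only on the local round number (and private randomness), and a station switches off permanently right after its first successful transmission. An adaptive adversary decides online which station to activate and when, knowing the algorithm's code and the history of the computation but not future randomness; in total it activates $k$ stations. Protocol NonAdaptiveWithK$(k,c)$ (executed by each station from its activation, $\log$ is base $2$): for $0\le l\le \log\log k$ let $\varphi(l)=k/2^l$ if $l<\log\log k$ and $\varphi(l)=k$ if $l=\log\log k$. For $l=0,1,2,\ldots,\log\log k$: for $c\varphi(l)$ rounds, transmit in each round with probability $\frac{2^l}{2k}$, independently over rounds and stations. A station that has finished all iterations transmits no more. Quantities such as $\log\log k$ and $k/2^l$ are treated as integers (rounding is ignored). *)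

theory Defs
  imports "HOL-Probability.Probability"
begin

text \<open>Stations are the numbers below \<open>k\<close>. Entry \<open>t\<close> of a history belongs to global round \<open>t\<close>: the
  set of stations activated in that round, and the set of stations transmitting in it. As the only
  random choices are the decisions to transmit, this is the complete record of the computation.\<close>

type_synonym history = "(nat set \<times> nat set) list"

definition activated_in :: "history \<Rightarrow> nat \<Rightarrow> nat \<Rightarrow> bool" where
  "activated_in h i s \<longleftrightarrow> s < length h \<and> i \<in> fst (h ! s)"

definition successful_in :: "history \<Rightarrow> nat \<Rightarrow> nat \<Rightarrow> bool" where
  "successful_in h i s \<longleftrightarrow> s < length h \<and> snd (h ! s) = {i}"

text \<open>An adaptive adversary maps the history of all earlier rounds to the stations it wants to
  activate in the current round. Stations that do not exist or have already been activated are
  discarded, so each station is activated at most once.\<close>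

type_synonym adversary = "history \<Rightarrow> nat set"

definition new_activations :: "nat \<Rightarrow> adversary \<Rightarrow> history \<Rightarrow> nat set" where
  "new_activations k adv h = {i. i < k \<and> i \<in> adv h \<and> \<not> (\<exists>s. activated_in h i s)}"

text \<open>The coin \<open>(i, j)\<close> tells whether station \<open>i\<close> transmits in its local round \<open>j\<close>, provided it has
  not been switched off by then. The current global round is \<open>length h\<close>; a station activated in
  global round \<open>s\<close> has local round \<open>length h - s\<close>, which is positive.\<close>

definition transmitters :: "(nat \<times> nat \<Rightarrow> bool) \<Rightarrow> history \<Rightarrow> nat set" where
  "transmitters \<omega> h =
     {i. \<not> (\<exists>s. successful_in h i s) \<and> (\<exists>s. activated_in h i s \<and> \<omega> (i, length h - s))}"

fun run :: "nat \<Rightarrow> adversary \<Rightarrow> (nat \<times> nat \<Rightarrow> bool) \<Rightarrow> nat \<Rightarrow> history" where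
  "run k adv \<omega> 0 = []"
| "run k adv \<omega> (Suc t) =
     (let h = run k adv \<omega> t in h @ [(new_activations k adv h, transmitters \<omega> h)])"

definition activation :: "nat \<Rightarrow> adversary \<Rightarrow> (nat \<times> nat \<Rightarrow> bool) \<Rightarrow> nat \<Rightarrow> nat \<Rightarrow> bool" where
  "activation k adv \<omega> i t \<longleftrightarrow> activated_in (run k adv \<omega> (Suc t)) i t"

definition success :: "nat \<Rightarrow> adversary \<Rightarrow> (nat \<times> nat \<Rightarrow> bool) \<Rightarrow> nat \<Rightarrow> nat \<Rightarrow> bool" where
  "success k adv \<omega> i t \<longleftrightarrow> successful_in (run k adv \<omega> (Suc t)) i t"

text \<open>A non-adaptive algorithm is given by its transmission probability \<open>p j\<close> in local round \<open>j\<close>.\<close>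

definition coins :: "(nat \<Rightarrow> real) \<Rightarrow> (nat \<times> nat \<Rightarrow> bool) measure" where
  "coins p = PiM UNIV (\<lambda>(i, j). measure_pmf (bernoulli_pmf (p j)))"

definition activates_all :: "nat \<Rightarrow> (nat \<Rightarrow> real) \<Rightarrow> adversary \<Rightarrow> bool" where
  "activates_all k p adv \<longleftrightarrow> (AE \<omega> in coins p. \<forall>i<k. \<exists>t. activation k adv \<omega> i t)"

text \<open>Rounding convention for NonAdaptiveWithK: \<open>log log k\<close> and \<open>k / 2 ^ l\<close> are rounded up.\<close>

definition loglog :: "nat \<Rightarrow> nat" where
  "loglog k = nat \<lceil>log 2 (log 2 (real k))\<rceil>"

definition phi :: "nat \<Rightarrow> nat \<Rightarrow> nat" where
  "phi k l = (if l < loglog k then nat \<lceil>real k / 2 ^ l\<rceil> else k)"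

definition schedule :: "nat \<Rightarrow> nat \<Rightarrow> real list" where
  "schedule k c =
     concat (map (\<lambda>l. replicate (c * phi k l) (2 ^ l / (2 * real k))) [0..<Suc (loglog k)])"

text \<open>Local rounds are counted from 1, list positions from 0.\<close>

definition NonAdaptiveWithK :: "nat \<Rightarrow> nat \<Rightarrow> nat \<Rightarrow> real" where
  "NonAdaptiveWithK k c j =
     (if 1 \<le> j \<and> j \<le> length (schedule k c) then schedule k c ! (j - 1) else 0)"

text \<open>\<^const>\<open>bernoulli_pmf\<close> truncates its argument to the unit interval; this never takes effect:\<close>

lemma NonAdaptiveWithK_bounds:
  assumes "k \<ge> 2"
  shows "0 \<le> NonAdaptiveWithK k c j \<and> NonAdaptiveWithK k c j \<le> 1"
proof -
  have lg: "log 2 (real k) \<ge> 1" "log 2 (real k) \<le> real k"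
    using assms log2_of_power_le[of k k] less_exp[of k] by (auto simp: le_log_iff)
  then have ge0: "log 2 (log 2 (real k)) \<ge> 0" using assms by (subst zero_le_log_cancel_iff) auto
  have *: "2 ^ l / (2 * real k) \<le> 1" if "l \<le> loglog k" for l
  proof -
    have "real l \<le> log 2 (log 2 (real k)) + 1"
      using that ge0 unfolding loglog_def by linarith
    then have "(2::real) powr real l \<le> 2 powr (log 2 (log 2 (real k)) + 1)" by simp
    also have "\<dots> = 2 * log 2 (real k)" using lg assms by (simp add: powr_add)
    finally show ?thesis using lg assms by (simp add: powr_realpow)
  qed
  have "\<forall>x\<in>set (schedule k c). 0 \<le> x \<and> x \<le> 1"
    using * by (auto simp: schedule_def less_Suc_eq_le)
  then show ?thesis unfolding NonAdaptiveWithK_def by auto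
qed

end

theory Submission
  imports Defs
begin

text \<open>Up to the first success, a station in local round \<open>j\<close> succeeds with probability at least a third of
  its transmission probability \<open>p j\<close>, provided that the load, i.e. the sum of the transmission probabilities
  of all active stations, is at most \<open>2 / 3\<close>. The load can only exceed this bound if for some \<open>l \<ge> 1\<close>
  at least \<open>k / 8 ^ l\<close> active stations have reached iteration \<open>l\<close>. Call this, and likewise
  the event that a station completes the whole schedule without success, a bad event. Each bad event is
  controlled by an exponential potential, a product over the stations, which is a
  supermartingale as long as nothing bad has happened: a successful transmission removes the factor of
  the transmitter, and this outweighs the growth of the other factors. By the maximal inequality
  the probability of a bad event is at most the sum of the initial potentials.\<close>

section \<open>Runs\<close>

lemma activated_in_append [simp]:
  "activated_in (h @ [x]) i s \<longleftrightarrow> activated_in h i s \<or> s = length h \<and> i \<in> fst x"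
  by (cases "s < length h"; cases "s = length h") (simp_all add: activated_in_def nth_append)

lemma successful_in_append [simp]:
  "successful_in (h @ [x]) i s \<longleftrightarrow> successful_in h i s \<or> s = length h \<and> snd x = {i}"
  by (cases "s < length h"; cases "s = length h") (simp_all add: successful_in_def nth_append)

lemma activated_in_less: "activated_in h i s \<Longrightarrow> s < length h"
  by (simp add: activated_in_def)

definition succeeded :: "history \<Rightarrow> nat \<Rightarrow> bool" where
  "succeeded h i \<longleftrightarrow> (\<exists>s. successful_in h i s)"

definition activated :: "history \<Rightarrow> nat \<Rightarrow> bool" where
  "activated h i \<longleftrightarrow> (\<exists>s. activated_in h i s)"

definition active :: "history \<Rightarrow> nat set" where
  "active h = {i. activated h i \<and> \<not> succeeded h i}"

text \<open>The number of local rounds that a station has completed; it is \<open>0\<close> for a sleeping station.\<close>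

definition age :: "history \<Rightarrow> nat \<Rightarrow> nat" where
  "age h i = card {n. n < length h \<and> (\<exists>s<n. activated_in h i s)}"

lemma Nil_simps [simp]:
  "\<not> activated_in [] i s" "\<not> successful_in [] i s" "\<not> activated [] i" "\<not> succeeded [] i" "age [] i = 0"
  by (auto simp: activated_in_def successful_in_def activated_def succeeded_def age_def)

lemma activated_append [simp]: "activated (h @ [x]) i \<longleftrightarrow> activated h i \<or> i \<in> fst x"
  by (auto simp: activated_def)

lemma succeeded_append [simp]: "succeeded (h @ [x]) i \<longleftrightarrow> succeeded h i \<or> snd x = {i}"
  by (auto simp: succeeded_def)

lemma age_append [simp]: "age (h @ [x]) i = (if activated h i then Suc (age h i) else age h i)"
proof -
  let ?S = "{n. n < length h \<and> (\<exists>s<n. activated_in h i s)}"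
  have "{n. n < length (h @ [x]) \<and> (\<exists>s<n. activated_in (h @ [x]) i s)}
      = (if activated h i then insert (length h) ?S else ?S)"
    by (auto simp: activated_def less_Suc_eq dest: activated_in_less)
  then show ?thesis unfolding age_def by simp
qed

lemma length_run [simp]: "length (run k adv \<omega> t) = t"
  by (induction t) (auto simp: Let_def)

lemma run_Suc:
  "run k adv \<omega> (Suc t) = run k adv \<omega> t @
     [(new_activations k adv (run k adv \<omega> t), transmitters \<omega> (run k adv \<omega> t))]"
  by (simp add: Let_def)

declare run.simps(2) [simp del] run_Suc [simp]

lemma transmitters_subset_active: "transmitters \<omega> h \<subseteq> active h"
  by (auto simp: transmitters_def active_def activated_def succeeded_def)

lemma activated_run_less: "activated (run k adv \<omega> t) i \<Longrightarrow> i < k"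
  by (induction t) (auto simp: new_activations_def)

lemma active_run_subset: "active (run k adv \<omega> t) \<subseteq> {..<k}"
  by (auto simp: active_def dest: activated_run_less)

lemma finite_active_run [simp]: "finite (active (run k adv \<omega> t))"
  by (rule finite_subset[OF active_run_subset]) simp

lemma activated_in_run_unique:
  "activated_in (run k adv \<omega> t) i s \<Longrightarrow> activated_in (run k adv \<omega> t) i s' \<Longrightarrow> s = s'"
  by (induction t) (auto simp: new_activations_def)

lemma activated_in_run_mono:
  "t \<le> t' \<Longrightarrow> activated_in (run k adv \<omega> t) i s \<Longrightarrow> activated_in (run k adv \<omega> t') i s"
  by (induction rule: dec_induct) auto

lemma successful_in_run_Suc:
  "successful_in (run k adv \<omega> t) i s \<Longrightarrow> successful_in (run k adv \<omega> (Suc s)) i s"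
proof (induction t)
  case (Suc t)
  then show ?case by (cases "s = t") auto
qed simp

lemma successful_in_run_activated:
  "successful_in (run k adv \<omega> t) i s \<Longrightarrow> \<exists>r<s. activated_in (run k adv \<omega> t) i r"
proof (induction t)
  case (Suc t)
  show ?case
  proof (cases "successful_in (run k adv \<omega> t) i s")
    case True
    then show ?thesis using Suc.IH by auto
  next
    case False
    then have "s = t" "transmitters \<omega> (run k adv \<omega> t) = {i}" using Suc.prems by auto
    then have "i \<in> active (run k adv \<omega> t)" using transmitters_subset_active by blast
    then obtain r where "activated_in (run k adv \<omega> t) i r"
      by (auto simp: active_def activated_def)
    then show ?thesis using activated_in_less \<open>s = t\<close> by fastforce
  qed
qed simp

text \<open>A station activated in round \<open>s\<close> has completed the local rounds of the
  global rounds \<open>s + 1, ..., t - 1\<close>. So \<open>t - s\<close>, the local round it plays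
  in global round \<open>t\<close>, is one more than its age.\<close>

lemma Suc_age_run:
  assumes "activated_in (run k adv \<omega> t) i s"
  shows "Suc (age (run k adv \<omega> t) i) = t - s"
proof -
  let ?h = "run k adv \<omega> t"
  have "(\<exists>s'<n. activated_in ?h i s') \<longleftrightarrow> s < n" for n
    using assms activated_in_run_unique by metis
  then have "{n. n < length ?h \<and> (\<exists>s<n. activated_in ?h i s)} = {s<..<t}"
    by auto
  then show ?thesis
    using activated_in_less[OF assms] by (simp add: age_def)
qed

text \<open>The coins \<open>\<omega>'\<close> may differ from those that produced the history: a
  fixed past can thus be combined with arbitrary fresh coins.\<close>

lemma transmitters_run:
  "transmitters \<omega>' (run k adv \<omega> t) =
     {i \<in> active (run k adv \<omega> t). \<omega>' (i, Suc (age (run k adv \<omega> t) i))}"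
  unfolding transmitters_def active_def activated_def succeeded_def
  by (auto simp: Suc_age_run)

definition next_coins :: "history \<Rightarrow> (nat \<times> nat) set" where
  "next_coins h = (\<lambda>i. (i, Suc (age h i))) ` active h"

text \<open>A station activated in round \<open>s\<close> reads its coin \<open>t - s\<close> in
  round \<open>t\<close> and only smaller indices before. Hence the first \<open>t\<close> rounds
  are determined by the coins outside \<open>next_coins\<close>, which makes the coins of the next
  round independent of the past, whatever the adversary does.\<close>

lemma run_cong_next_coins:
  assumes "\<And>c. c \<notin> next_coins (run k adv \<omega> t) \<Longrightarrow> \<omega>' c = \<omega> c" and "n \<le> t"
  shows "run k adv \<omega>' n = run k adv \<omega> n"
  using assms(2)
proof (induction n)
  case (Suc n)
  let ?h = "run k adv \<omega> n" and ?g = "run k adv \<omega> t"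
  have IH: "run k adv \<omega>' n = ?h" using Suc by simp
  have "\<omega>' (i, Suc (age ?h i)) = \<omega> (i, Suc (age ?h i))" if i: "i \<in> active ?h" for i
  proof (rule assms(1))
    obtain s where s: "activated_in ?h i s" using i by (auto simp: active_def activated_def)
    then have s': "activated_in ?g i s" using activated_in_run_mono Suc.prems by (metis Suc_leD)
    have "Suc (age ?h i) = n - s" "Suc (age ?g i) = t - s" "s < n"
      using Suc_age_run[OF s] Suc_age_run[OF s'] activated_in_less[OF s] by auto
    then show "(i, Suc (age ?h i)) \<notin> next_coins ?g"
      using Suc.prems unfolding next_coins_def by auto
  qed
  then have "transmitters \<omega>' ?h = transmitters \<omega> ?h"
    by (auto simp: transmitters_run)
  then show ?case by (simp add: IH)
qed auto

lemma run_in_lists: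
  "set (run k adv \<omega> t) \<subseteq> Pow {..<k} \<times> Pow {..<k}"
proof (induction t)
  case (Suc t)
  have "transmitters \<omega> (run k adv \<omega> t) \<subseteq> {..<k}"
    using transmitters_subset_active active_run_subset by blast
  then show ?case using Suc by (auto simp: new_activations_def)
qed auto

text \<open>Because only finitely many histories of each length occur, every event that is expressed
  by the history up to a fixed round is a finite union of events
  \<open>R \<omega> t = h\<close>.\<close>

lemma finite_range_run: "finite (range (\<lambda>\<omega>. run k adv \<omega> t))"
proof (rule finite_subset)
  show "range (\<lambda>\<omega>. run k adv \<omega> t) \<subseteq> {h. set h \<subseteq> Pow {..<k} \<times> Pow {..<k} \<and> length h = t}"
    using run_in_lists[of k adv _ t] by auto
  show "finite {h. set h \<subseteq> Pow {..<k} \<times> Pow {..<k} \<and> length h = t}"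
    by (intro finite_lists_length_eq) auto
qed

section \<open>Probability of histories\<close>

text \<open>The assumption \<open>indep\<close> says that \<open>A\<close> is determined by the
  coordinates outside \<open>J\<close>, whereas the cylinder is determined by those in
  \<open>J\<close>. These two blocks of coordinates are independent.\<close>

lemma measure_PiM_pmf_cylinder:
  fixes D :: "'i \<Rightarrow> 'a pmf"
  defines "M \<equiv> PiM UNIV (\<lambda>i. measure_pmf (D i))"
  assumes A: "A \<in> sets M" and J: "finite J"
    and indep: "\<And>\<omega> \<omega>'. \<omega> \<in> A \<Longrightarrow> (\<And>i. i \<notin> J \<Longrightarrow> \<omega>' i = \<omega> i) \<Longrightarrow> \<omega>' \<in> A"
  shows "measure M (A \<inter> {\<omega>. \<forall>i\<in>J. \<omega> i = b i}) = measure M A * (\<Prod>i\<in>J. pmf (D i) (b i))"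
proof -
  interpret product_prob_space "\<lambda>i. measure_pmf (D i)" UNIV by unfold_locales
  interpret M: prob_space M unfolding M_def by (rule P.prob_space_axioms)
  have sp: "space M = UNIV" by (simp add: M_def space_PiM)
  have ind: "M.indep_vars (\<lambda>i. measure_pmf (D i)) (\<lambda>i \<omega>. \<omega> i) UNIV"
  proof (subst M.indep_vars_iff_distr_eq_PiM)
    show "distr M (Pi\<^sub>M UNIV (\<lambda>i. measure_pmf (D i))) (\<lambda>x. \<lambda>i\<in>UNIV. x i) =
      Pi\<^sub>M UNIV (\<lambda>i. distr M (measure_pmf (D i)) (\<lambda>\<omega>. \<omega> i))"
      unfolding M_def by (subst PiM_component) (auto simp: restrict_def)
  qed (auto simp: M_def)
  have iv: "M.indep_var (PiM (- J) (\<lambda>i. measure_pmf (D i))) (\<lambda>\<omega>. restrict (\<lambda>i. \<omega> i) (- J))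
      (PiM J (\<lambda>i. measure_pmf (D i))) (\<lambda>\<omega>. restrict (\<lambda>i. \<omega> i) J)"
    using ind by (rule M.indep_var_restrict) auto
  \<comment> \<open>Filling the coordinates in \<open>J\<close> with the values \<open>b\<close> is
    measurable and does not affect membership in \<open>A\<close>. This exhibits \<open>A\<close> as
    the preimage of a measurable set \<open>A'\<close> under restriction to
    \<open>- J\<close>.\<close>
  define ext :: "('i \<Rightarrow> 'a) \<Rightarrow> 'i \<Rightarrow> 'a" where "ext f = (\<lambda>i. if i \<in> J then b i else f i)" for f
  have ext: "ext \<in> measurable (PiM (- J) (\<lambda>i. measure_pmf (D i))) M"
    unfolding M_def
  proof (rule measurable_PiM_single')
    show "(\<lambda>f. ext f i) \<in> measurable (PiM (- J) (\<lambda>i. measure_pmf (D i))) (measure_pmf (D i))" for i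
    proof (cases "i \<in> J")
      case False
      then have "(\<lambda>f. f i) \<in> measurable (PiM (- J) (\<lambda>i. measure_pmf (D i))) (measure_pmf (D i))"
        by (intro measurable_component_singleton) simp
      with False show ?thesis by (simp add: ext_def)
    qed (simp add: ext_def)
  qed (auto simp: ext_def)
  define A' where "A' = ext -` A \<inter> space (PiM (- J) (\<lambda>i. measure_pmf (D i)))"
  have A': "A' \<in> sets (PiM (- J) (\<lambda>i. measure_pmf (D i)))"
    unfolding A'_def using measurable_sets[OF ext A] .
  define B where "B = PiE J (\<lambda>i. {b i})"
  have B: "B \<in> sets (PiM J (\<lambda>i. measure_pmf (D i)))"
    unfolding B_def using J by (intro sets_PiM_I_finite) auto
  have preA: "(\<lambda>\<omega>. restrict (\<lambda>i. \<omega> i) (- J)) -` A' \<inter> space M = A"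
  proof -
    have "ext (restrict \<omega> (- J)) \<in> A \<longleftrightarrow> \<omega> \<in> A" for \<omega>
      by (auto simp: ext_def intro: indep)
    then show ?thesis by (auto simp: A'_def sp space_PiM)
  qed
  have preB: "(\<lambda>\<omega>. restrict (\<lambda>i. \<omega> i) J) -` B \<inter> space M = {\<omega>. \<forall>i\<in>J. \<omega> i = b i}"
    by (auto simp: B_def sp PiE_iff)
  have "measure M {\<omega>. \<forall>i\<in>J. \<omega> i = b i} = (\<Prod>i\<in>J. pmf (D i) (b i))"
  proof -
    have "{\<omega>. \<forall>i\<in>J. \<omega> i = b i} = prod_emb UNIV (\<lambda>i. measure_pmf (D i)) J (Pi\<^sub>E J (\<lambda>i. {b i}))"
      by (auto simp: prod_emb_def PiE_iff space_PiM)
    then show ?thesis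
      unfolding M_def using J by (simp add: measure_PiM_emb measure_pmf_single)
  qed
  moreover have "A \<inter> {\<omega>. \<forall>i\<in>J. \<omega> i = b i} =
      (\<lambda>\<omega>. (restrict (\<lambda>i. \<omega> i) (- J), restrict (\<lambda>i. \<omega> i) J)) -` (A' \<times> B) \<inter> space M"
    using preA preB by auto
  ultimately show ?thesis
    using M.indep_varD[OF iv A' B] preA preB by simp
qed

section \<open>The process of histories for an arbitrary transmission schedule and adversary\<close>

locale channel =
  fixes k :: nat and p :: "nat \<Rightarrow> real" and adv :: adversary
  assumes p_nonneg: "0 \<le> p j" and p_le_1: "p j \<le> 1"
begin

abbreviation R :: "(nat \<times> nat \<Rightarrow> bool) \<Rightarrow> nat \<Rightarrow> history" where
  "R \<omega> t \<equiv> run k adv \<omega> t"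

abbreviation coin_pmf :: "nat \<times> nat \<Rightarrow> bool pmf" where
  "coin_pmf c \<equiv> bernoulli_pmf (p (snd c))"

lemma coins_eq: "coins p = PiM UNIV (\<lambda>c. measure_pmf (coin_pmf c))"
  unfolding coins_def by (intro arg_cong[where f = "PiM UNIV"]) auto

lemma space_coins [simp]: "space (coins p) = UNIV"
  by (simp add: coins_eq space_PiM)

sublocale prob_space "coins p"
  unfolding coins_eq by (intro prob_space_PiM) (rule measure_pmf.prob_space_axioms)

lemma coin_measurable [measurable]: "Measurable.pred (coins p) (\<lambda>\<omega>. \<omega> c)"
proof -
  have "(\<lambda>\<omega>. \<omega> c) \<in> measurable (coins p) (measure_pmf (coin_pmf c))"
    unfolding coins_eq by (rule measurable_component_singleton) simp
  then show ?thesis by (simp add: measurable_cong_sets)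
qed

lemma run_eq_measurable: "{\<omega>. R \<omega> t = h} \<in> events"
proof (induction t arbitrary: h)
  case 0
  have "{\<omega>. R \<omega> 0 = h} = (if h = [] then space (coins p) else {})" by auto
  then show ?case by (metis sets.empty_sets sets.top)
next
  case (Suc t)
  show ?case
  proof (cases "\<exists>g X. h = g @ [(new_activations k adv g, X)]")
    case True
    then obtain g X where h: "h = g @ [(new_activations k adv g, X)]" by auto
    have "{\<omega>. R \<omega> (Suc t) = h} = {\<omega>. R \<omega> t = g} \<inter> {\<omega>\<in>space (coins p). transmitters \<omega> g = X}"
      by (auto simp: h)
    moreover have "{\<omega>\<in>space (coins p). transmitters \<omega> g = X} \<in> events"
      unfolding set_eq_iff transmitters_def mem_Collect_eq by measurable
    ultimately show ?thesis using Suc by auto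
  next
    case False
    then have "{\<omega>. R \<omega> (Suc t) = h} = {}" by auto
    then show ?thesis by simp
  qed
qed

lemma pred_run_measurable [measurable]: "Measurable.pred (coins p) (\<lambda>\<omega>. P (R \<omega> t))"
proof -
  have "{\<omega>. P (R \<omega> t)} = (\<Union>h\<in>{h\<in>range (\<lambda>\<omega>. R \<omega> t). P h}. {\<omega>. R \<omega> t = h})" by auto
  also have "\<dots> \<in> events"
    by (intro sets.finite_UN run_eq_measurable) (simp add: finite_range_run)
  finally show ?thesis by (simp add: pred_def)
qed

text \<open>The conditional probability, given the history \<open>h\<close>, that exactly the
  stations in \<open>X\<close> transmit next.\<close>

definition step_prob :: "history \<Rightarrow> nat set \<Rightarrow> real" where
  "step_prob h X = (\<Prod>i\<in>active h. if i \<in> X then p (Suc (age h i)) else 1 - p (Suc (age h i)))"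

text \<open>Given \<open>h\<close>, the next activations are fixed by the adversary, and the next
  transmitters by the coins in \<open>next_coins h\<close>. The event of reaching \<open>h\<close>
  does not depend on these coins, so the probabilities multiply.\<close>

lemma prob_run_step:
  assumes h: "h = R \<omega>0 t" and X: "X \<subseteq> active h"
  shows "prob {\<omega>. R \<omega> (Suc t) = h @ [(new_activations k adv h, X)]} =
     prob {\<omega>. R \<omega> t = h} * step_prob h X"
proof -
  have fin: "finite (active h)" using h by simp
  have "{\<omega>. R \<omega> (Suc t) = h @ [(new_activations k adv h, X)]} =
      {\<omega>. R \<omega> t = h} \<inter> {\<omega>. transmitters \<omega> h = X}" by auto
  also have "{\<omega>. transmitters \<omega> h = X} = {\<omega>. \<forall>c\<in>next_coins h. \<omega> c = (fst c \<in> X)}"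
    using X unfolding h transmitters_run next_coins_def by auto
  also have "prob ({\<omega>. R \<omega> t = h} \<inter> {\<omega>. \<forall>c\<in>next_coins h. \<omega> c = (fst c \<in> X)}) =
      prob {\<omega>. R \<omega> t = h} * (\<Prod>c\<in>next_coins h. pmf (coin_pmf c) (fst c \<in> X))"
    unfolding coins_eq
  proof (rule measure_PiM_pmf_cylinder)
    show "finite (next_coins h)" using fin by (simp add: next_coins_def)
    show "{\<omega>. R \<omega> t = h} \<in> sets (PiM UNIV (\<lambda>c. measure_pmf (coin_pmf c)))"
      using run_eq_measurable by (simp add: coins_eq)
  qed (use run_cong_next_coins in blast)
  also have "(\<Prod>c\<in>next_coins h. pmf (coin_pmf c) (fst c \<in> X)) = step_prob h X"
    unfolding next_coins_def step_prob_def
    by (subst prod.reindex) (auto simp: inj_on_def p_nonneg p_le_1 intro!: prod.cong)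
  finally show ?thesis .
qed

text \<open>Ville's maximal inequality for the nonnegative process \<open>\<Psi>\<close>, which only has to be a
  supermartingale until it reaches \<open>1\<close>.\<close>

lemma maximal_inequality_from:
  assumes nonneg: "\<And>h. \<Psi> h \<ge> 0"
    and super: "\<And>\<omega> t h. h = R \<omega> t \<Longrightarrow> \<Psi> h < 1 \<Longrightarrow>
      (\<Sum>X\<in>Pow (active h). step_prob h X * \<Psi> (h @ [(new_activations k adv h, X)])) \<le> \<Psi> h"
  shows "prob {\<omega>. R \<omega> t = h \<and> (\<exists>n\<in>{t..t + m}. 1 \<le> \<Psi> (R \<omega> n))} \<le> prob {\<omega>. R \<omega> t = h} * \<Psi> h"
proof (induction m arbitrary: t h)
  case 0
  show ?case
  proof (cases "1 \<le> \<Psi> h")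
    case True
    have "prob {\<omega>. R \<omega> t = h \<and> (\<exists>n\<in>{t..t + 0}. 1 \<le> \<Psi> (R \<omega> n))} \<le> prob {\<omega>. R \<omega> t = h} * 1"
      using run_eq_measurable by (auto intro!: finite_measure_mono)
    also have "\<dots> \<le> prob {\<omega>. R \<omega> t = h} * \<Psi> h"
      using True by (intro mult_left_mono) auto
    finally show ?thesis .
  next
    case False
    then have "{\<omega>. R \<omega> t = h \<and> (\<exists>n\<in>{t..t + 0}. 1 \<le> \<Psi> (R \<omega> n))} = {}" by auto
    then show ?thesis using nonneg by (metis measure_empty measure_nonneg mult_nonneg_nonneg)
  qed
next
  case (Suc m)
  let ?bad = "\<lambda>t h m. {\<omega>. R \<omega> t = h \<and> (\<exists>n\<in>{t..t + m}. 1 \<le> \<Psi> (R \<omega> n))}"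
  let ?ext = "\<lambda>X. h @ [(new_activations k adv h, X)]"
  consider "1 \<le> \<Psi> h" | "\<nexists>\<omega>. R \<omega> t = h" | \<omega> where "h = R \<omega> t" "\<Psi> h < 1" by force
  then show ?case
  proof cases
    case 1
    have "prob (?bad t h (Suc m)) \<le> prob {\<omega>. R \<omega> t = h} * 1"
      using run_eq_measurable by (auto intro!: finite_measure_mono)
    also have "\<dots> \<le> prob {\<omega>. R \<omega> t = h} * \<Psi> h"
      using 1 by (intro mult_left_mono) auto
    finally show ?thesis .
  next
    case 2
    then have "?bad t h (Suc m) = {}" by auto
    then show ?thesis using nonneg by (metis measure_empty measure_nonneg mult_nonneg_nonneg)
  next
    case 3
    have fin: "finite (Pow (active h))" using 3 by simp
    have bad_events: "?bad t' h' m' \<in> events" for t' h' m'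
    proof -
      have "{\<omega> \<in> space (coins p). R \<omega> t' = h' \<and> (\<exists>n\<in>{t'..t' + m'}. 1 \<le> \<Psi> (R \<omega> n))} \<in> events"
        by measurable
      then show ?thesis by simp
    qed
    \<comment> \<open>Since \<open>\<Psi> h < 1\<close>, the level \<open>1\<close> can only be
      reached after round \<open>t\<close>, so the event splits according to the next set of
      transmitters.\<close>
    have "?bad t h (Suc m) \<subseteq> (\<Union>X\<in>Pow (active h). ?bad (Suc t) (?ext X) m)"
    proof
      fix \<omega> assume *: "\<omega> \<in> ?bad t h (Suc m)"
      then obtain n where n: "n \<in> {t..t + Suc m}" "1 \<le> \<Psi> (R \<omega> n)" and h: "R \<omega> t = h" by auto
      with 3 have "n \<noteq> t" by auto
      with n have "n \<in> {Suc t..Suc t + m}" by auto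
      moreover have "R \<omega> (Suc t) = ?ext (transmitters \<omega> h)" using h by simp
      ultimately show "\<omega> \<in> (\<Union>X\<in>Pow (active h). ?bad (Suc t) (?ext X) m)"
        using n transmitters_subset_active by blast
    qed
    then have "prob (?bad t h (Suc m)) \<le> prob (\<Union>X\<in>Pow (active h). ?bad (Suc t) (?ext X) m)"
      using fin by (intro finite_measure_mono sets.finite_UN bad_events)
    also have "\<dots> \<le> (\<Sum>X\<in>Pow (active h). prob (?bad (Suc t) (?ext X) m))"
      using fin by (intro finite_measure_subadditive_finite image_subsetI bad_events)
    also have "\<dots> \<le> (\<Sum>X\<in>Pow (active h). prob {\<omega>. R \<omega> (Suc t) = ?ext X} * \<Psi> (?ext X))"
      by (intro sum_mono Suc.IH)
    also have "\<dots> = (\<Sum>X\<in>Pow (active h). prob {\<omega>. R \<omega> t = h} * (step_prob h X * \<Psi> (?ext X)))"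
      by (intro sum.cong refl) (simp only: prob_run_step[OF 3(1)] Pow_iff mult.assoc)
    also have "\<dots> = prob {\<omega>. R \<omega> t = h} * (\<Sum>X\<in>Pow (active h). step_prob h X * \<Psi> (?ext X))"
      by (simp add: sum_distrib_left)
    also have "\<dots> \<le> prob {\<omega>. R \<omega> t = h} * \<Psi> h"
      using super[OF 3] by (intro mult_left_mono) auto
    finally show ?thesis .
  qed
qed

text \<open>The bound for a finite horizon is uniform in the horizon, so it carries over to the
  increasing union.\<close>

lemma maximal_inequality:
  assumes nonneg: "\<And>h. \<Psi> h \<ge> 0"
    and super: "\<And>\<omega> t h. h = R \<omega> t \<Longrightarrow> \<Psi> h < 1 \<Longrightarrow>
      (\<Sum>X\<in>Pow (active h). step_prob h X * \<Psi> (h @ [(new_activations k adv h, X)])) \<le> \<Psi> h"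
  shows "prob {\<omega>. \<exists>n. 1 \<le> \<Psi> (R \<omega> n)} \<le> \<Psi> []"
proof -
  let ?B = "\<lambda>m. {\<omega> \<in> space (coins p). \<exists>n\<in>{0..m}. 1 \<le> \<Psi> (R \<omega> n)}"
  have "(\<lambda>m. prob (?B m)) \<longlonglongrightarrow> prob (\<Union>m. ?B m)"
  proof (rule finite_Lim_measure_incseq)
    have "?B m \<in> events" for m by measurable
    then show "range ?B \<subseteq> events" by blast
    show "incseq ?B" by (rule monoI) force
  qed
  moreover have "prob (?B m) \<le> \<Psi> []" for m
    using maximal_inequality_from[where \<Psi> = \<Psi> and t = 0 and h = "[]" and m = m, OF nonneg super] prob_space by simp
  ultimately have "prob (\<Union>m. ?B m) \<le> \<Psi> []"
    by (intro LIMSEQ_le_const2) auto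
  also have "(\<Union>m. ?B m) = {\<omega>. \<exists>n. 1 \<le> \<Psi> (R \<omega> n)}" by fastforce
  finally show ?thesis .
qed

end

section \<open>The potential\<close>

text \<open>The total mass of the law of a random set that contains each \<open>i\<close>
  independently with probability \<open>q i\<close>: expand the product of the factors
  \<open>q i + (1 - q i)\<close>.\<close>

lemma sum_subset_weights:
  fixes q :: "'a \<Rightarrow> real"
  assumes "finite A"
  shows "(\<Sum>X\<in>Pow A. \<Prod>i\<in>A. if i \<in> X then q i else 1 - q i) = 1"
proof -
  have "(\<Prod>i\<in>A. if i \<in> X then q i else 1 - q i) = prod q X * (\<Prod>i\<in>A - X. 1 - q i)"
    if "X \<subseteq> A" for X
  proof -
    have "A \<inter> X = X" "A \<inter> - X = A - X" using that by auto
    then show ?thesis using assms by (simp add: prod.If_cases)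
  qed
  then have "(\<Sum>X\<in>Pow A. \<Prod>i\<in>A. if i \<in> X then q i else 1 - q i)
      = (\<Prod>i\<in>A. q i + (1 - q i))"
    using assms by (subst prod_add) (auto intro!: sum.cong)
  then show ?thesis by simp
qed

text \<open>The sum is an expectation over the random set \<open>X\<close> of transmitters. With probability at least
  \<open>q i / 3\<close> the station \<open>i\<close> transmits alone, which removes its factor from the product; the
  Weierstrass product inequality turns the resulting linear gain into a product.\<close>

lemma expected_potential_le:
  fixes q z :: "'a \<Rightarrow> real"
  assumes A: "finite A" and q: "\<And>i. i \<in> A \<Longrightarrow> 0 \<le> q i" "\<And>i. i \<in> A \<Longrightarrow> q i \<le> 1"
    and sum_q: "sum q A \<le> 2 / 3" and z: "\<And>i. i \<in> A \<Longrightarrow> 0 \<le> z i"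
  shows "(\<Sum>X\<in>Pow A. (\<Prod>i\<in>A. if i \<in> X then q i else 1 - q i) *
             (\<Prod>i\<in>A. if X = {i} then 1 else 1 + z i))
      \<le> (\<Prod>i\<in>A. 1 + z i * (1 - q i / 3))"
proof -
  let ?r = "\<lambda>X. \<Prod>i\<in>A. if i \<in> X then q i else 1 - q i"
  let ?Z = "\<Prod>i\<in>A. 1 + z i"
  \<comment> \<open>\<open>v i\<close> is the relative loss when the factor \<open>1 + z i\<close>
    is replaced by \<open>1\<close>. As \<open>X = {i}\<close> holds for at most one
    \<open>i\<close>, the product for \<open>X\<close> is \<open>?Z\<close> times one minus a sum
    with at most one nonzero term.\<close>
  define v where "v i = z i / (1 + z i)" for i
  have v: "0 \<le> v i" "v i \<le> 1" "(1 + z i) * (1 - v i) = 1" "(1 + z i) * v i = z i"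
    if "i \<in> A" for i
    using z[OF that] by (auto simp: v_def field_simps)
  have Z: "0 \<le> ?Z" using z by (intro prod_nonneg) (simp add: add_nonneg_nonneg)
  have factor: "(\<Prod>i\<in>A. if X = {i} then 1 else 1 + z i) = ?Z * (1 - (\<Sum>i\<in>A. if X = {i} then v i else 0))"
    for X
  proof (cases "\<exists>i\<in>A. X = {i}")
    case True
    then obtain i where i: "i \<in> A" "X = {i}" by auto
    have "(\<Prod>j\<in>A. if X = {j} then 1 else 1 + z j) = (\<Prod>j\<in>A - {i}. 1 + z j)"
      using i A by (subst prod.remove[of _ i]) (auto intro!: prod.cong)
    moreover have "(\<Sum>j\<in>A. if X = {j} then v j else 0) = v i"
      using i A by (simp add: eq_commute[of i] cong: if_cong)
    moreover have "?Z = (1 + z i) * (\<Prod>j\<in>A - {i}. 1 + z j)"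
      using i A by (simp add: prod.remove)
    moreover have "(1 + z i) * (\<Prod>j\<in>A - {i}. 1 + z j) * (1 - v i) = (\<Prod>j\<in>A - {i}. 1 + z j)"
      using v(3)[OF i(1)] by (metis mult.commute mult.left_commute mult_1)
    ultimately show ?thesis by simp
  next
    case False
    then have "(\<Prod>i\<in>A. if X = {i} then 1 else 1 + z i) = ?Z"
      "(\<Sum>i\<in>A. if X = {i} then v i else 0) = 0"
      by (auto intro!: prod.cong sum.neutral)
    then show ?thesis by simp
  qed
  have alone: "?r {i} \<ge> q i / 3" if i: "i \<in> A" for i
  proof -
    \<comment> \<open>By the Weierstrass inequality all other stations stay silent with probability
      at least \<open>1 - sum q A\<close>; this is where the load bound \<open>2 / 3\<close>
      enters.\<close>
    have "1 / 3 \<le> 1 - sum q A" using sum_q by simp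
    also have "\<dots> \<le> 1 - sum q (A - {i})"
      using q A by (auto intro!: sum_mono2)
    also have "\<dots> \<le> (\<Prod>j\<in>A - {i}. 1 - q j)"
      using q by (intro Weierstrass_prod_ineq) auto
    finally have "q i * (1 / 3) \<le> q i * (\<Prod>j\<in>A - {i}. 1 - q j)"
      using q(1)[OF i] by (rule mult_left_mono)
    also have "\<dots> = ?r {i}"
      using i A by (subst (2) prod.remove[of _ i]) (auto intro!: prod.cong)
    finally show ?thesis by simp
  qed
  have "(\<Sum>X\<in>Pow A. ?r X * (\<Prod>i\<in>A. if X = {i} then 1 else 1 + z i))
      = (\<Sum>X\<in>Pow A. ?Z * (?r X - (\<Sum>i\<in>A. if X = {i} then v i * ?r X else 0)))"
    by (intro sum.cong refl)
      (simp add: factor algebra_simps sum_distrib_left sum_distrib_right if_distrib cong: if_cong)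
  also have "\<dots> = ?Z * ((\<Sum>X\<in>Pow A. ?r X) - (\<Sum>X\<in>Pow A. \<Sum>i\<in>A. if X = {i} then v i * ?r X else 0))"
    by (simp only: sum_distrib_left[symmetric] sum_subtractf)
  also have "(\<Sum>X\<in>Pow A. \<Sum>i\<in>A. if X = {i} then v i * ?r X else 0)
      = (\<Sum>i\<in>A. \<Sum>X\<in>Pow A. if X = {i} then v i * ?r X else 0)"
    by (rule sum.swap)
  also have "\<dots> = (\<Sum>i\<in>A. v i * ?r {i})"
    using A by (intro sum.cong refl) (subst sum.delta, auto)
  also have "(\<Sum>X\<in>Pow A. ?r X) = 1" using A by (rule sum_subset_weights)
  also have "?Z * (1 - (\<Sum>i\<in>A. v i * ?r {i})) \<le> ?Z * (1 - (\<Sum>i\<in>A. v i * (q i / 3)))"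
    using v alone by (intro mult_left_mono Z diff_left_mono sum_mono) auto
  also have "\<dots> \<le> ?Z * (\<Prod>i\<in>A. 1 - v i * (q i / 3))"
  proof (intro mult_left_mono Z Weierstrass_prod_ineq)
    fix i assume i: "i \<in> A"
    have "v i * (q i / 3) \<le> 1 * 1" using v[OF i] q[OF i] by (intro mult_mono) auto
    then show "v i * (q i / 3) \<in> {0..1}" using v[OF i] q[OF i] by simp
  qed
  also have "\<dots> = (\<Prod>i\<in>A. (1 + z i) * (1 - v i * (q i / 3)))" by (simp add: prod.distrib)
  also have "\<dots> = (\<Prod>i\<in>A. 1 + z i * (1 - q i / 3))"
  proof (intro prod.cong refl)
    fix i assume i: "i \<in> A"
    have "(1 + z i) * (1 - v i * (q i / 3)) = 1 + z i - (1 + z i) * v i * (q i / 3)"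
      by (simp add: algebra_simps)
    then show "(1 + z i) * (1 - v i * (q i / 3)) = 1 + z i * (1 - q i / 3)"
      unfolding v(4)[OF i] by (simp add: algebra_simps)
  qed
  finally show ?thesis .
qed

section \<open>Supermartingales under bounded load\<close>

context channel
begin

text \<open>As long as every transmission of probability \<open>q\<close> succeeds with probability at least \<open>q / 3\<close>,
  this bounds the probability that a station stays unsuccessful in its local rounds \<open>m + 1, \<dots>, \<tau>\<close>.\<close>

definition fail_bound :: "nat \<Rightarrow> nat \<Rightarrow> real" where
  "fail_bound \<tau> m = (\<Prod>j\<in>{m<..\<tau>}. 1 - p j / 3)"

text \<open>An upper estimate for the chance that the station reaches age \<open>\<tau>\<close>
  without success. A sleeping station has age \<open>0\<close> and thus the full
  \<open>fail_bound \<tau> 0\<close>; from age \<open>\<tau>\<close> on the product is empty and the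
  weight is \<open>1\<close>.\<close>

definition station_weight :: "nat \<Rightarrow> history \<Rightarrow> nat \<Rightarrow> real" where
  "station_weight \<tau> h i = (if succeeded h i then 0 else fail_bound \<tau> (age h i))"

text \<open>As in a Chernoff bound, this plays the role of the expectation of
  \<open>(1 + lam) ^ N\<close>, where \<open>N\<close> counts the stations that reach age
  \<open>\<tau>\<close> without success, as if these were independent events with probabilities
  \<open>station_weight\<close>.\<close>

definition potential :: "nat \<Rightarrow> real \<Rightarrow> history \<Rightarrow> real" where
  "potential \<tau> lam h = (\<Prod>i<k. 1 + lam * station_weight \<tau> h i)"

lemma fail_bound_nonneg: "0 \<le> fail_bound \<tau> m"
proof -
  have "p j / 3 \<le> 1" for j using p_le_1[of j] by simp
  then show ?thesis unfolding fail_bound_def by (intro prod_nonneg) simp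
qed

text \<open>Equality for \<open>m < \<tau>\<close>; from \<open>\<tau>\<close> on both products are
  empty and the additional factor is at most \<open>1\<close>.\<close>

lemma fail_bound_Suc: "fail_bound \<tau> (Suc m) * (1 - p (Suc m) / 3) \<le> fail_bound \<tau> m"
proof (cases "m < \<tau>")
  case True
  then have "{m<..\<tau>} = insert (Suc m) {Suc m<..\<tau>}" by auto
  then show ?thesis by (simp add: fail_bound_def)
next
  case False
  then show ?thesis using p_nonneg[of "Suc m"] by (simp add: fail_bound_def)
qed

lemma station_weight_nonneg: "0 \<le> station_weight \<tau> h i"
  using fail_bound_nonneg by (simp add: station_weight_def)

lemma potential_nonneg: "0 \<le> lam \<Longrightarrow> 0 \<le> potential \<tau> lam h"
  unfolding potential_def using station_weight_nonneg by (intro prod_nonneg) simp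

definition load :: "history \<Rightarrow> real" where
  "load h = (\<Sum>i\<in>active h. p (Suc (age h i)))"

text \<open>Only the factors of active stations change: stations that have succeeded keep the factor
  \<open>1\<close>, and sleeping stations, including those being activated now, keep age
  \<open>0\<close>. For the active ones, the gain \<open>1 - ?q i / 3\<close> from
  \<open>expected_potential_le\<close> pays for the increase of \<open>fail_bound\<close> with
  age.\<close>

lemma expected_potential_step:
  assumes h: "h = R \<omega> t" and load: "load h \<le> 2 / 3" and lam: "0 \<le> lam"
  shows "(\<Sum>X\<in>Pow (active h). step_prob h X *
            potential \<tau> lam (h @ [(new_activations k adv h, X)])) \<le> potential \<tau> lam h"
proof -
  let ?A = "active h" and ?q = "\<lambda>i. p (Suc (age h i))"
  let ?z = "\<lambda>i. lam * fail_bound \<tau> (Suc (age h i))"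
  let ?rest = "\<Prod>i\<in>{..<k} - ?A. 1 + lam * station_weight \<tau> h i"
  have sub: "?A \<subseteq> {..<k}" and fin: "finite ?A" using h active_run_subset by auto
  have rest: "0 \<le> ?rest"
    using station_weight_nonneg lam by (intro prod_nonneg) simp
  have split: "potential \<tau> lam g = (\<Prod>i\<in>{..<k} - ?A. 1 + lam * station_weight \<tau> g i) *
      (\<Prod>i\<in>?A. 1 + lam * station_weight \<tau> g i)" for g
    unfolding potential_def using sub by (intro prod.subset_diff) auto
  have next_potential: "potential \<tau> lam (h @ [(new_activations k adv h, X)]) =
      ?rest * (\<Prod>i\<in>?A. if X = {i} then 1 else 1 + ?z i)" if X: "X \<subseteq> ?A" for X
    unfolding split
    using X by (intro arg_cong2[where f = "(*)"] prod.cong)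
      (auto simp: station_weight_def active_def)
  have "(\<Sum>X\<in>Pow ?A. step_prob h X * potential \<tau> lam (h @ [(new_activations k adv h, X)]))
      = (\<Sum>X\<in>Pow ?A. ?rest * (step_prob h X * (\<Prod>i\<in>?A. if X = {i} then 1 else 1 + ?z i)))"
    by (intro sum.cong refl) (simp add: next_potential)
  also have "\<dots> = ?rest * (\<Sum>X\<in>Pow ?A. step_prob h X *
      (\<Prod>i\<in>?A. if X = {i} then 1 else 1 + ?z i))"
    by (simp add: sum_distrib_left)
  also have "\<dots> \<le> ?rest * (\<Prod>i\<in>?A. 1 + ?z i * (1 - ?q i / 3))"
    unfolding step_prob_def using fin load lam fail_bound_nonneg
    by (intro mult_left_mono rest expected_potential_le) (auto simp: p_nonneg p_le_1 load_def)
  also have "\<dots> \<le> ?rest * (\<Prod>i\<in>?A. 1 + lam * station_weight \<tau> h i)"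
  proof (intro mult_left_mono rest prod_mono conjI)
    fix i assume i: "i \<in> ?A"
    have "?q i / 3 \<le> 1" using p_le_1[of "Suc (age h i)"] by simp
    then show "0 \<le> 1 + ?z i * (1 - ?q i / 3)"
      using lam fail_bound_nonneg by (intro add_nonneg_nonneg mult_nonneg_nonneg) auto
    have "lam * (fail_bound \<tau> (Suc (age h i)) * (1 - ?q i / 3)) \<le> lam * fail_bound \<tau> (age h i)"
      using lam by (intro mult_left_mono fail_bound_Suc)
    then show "1 + ?z i * (1 - ?q i / 3) \<le> 1 + lam * station_weight \<tau> h i"
      using i by (simp add: station_weight_def active_def mult.assoc)
  qed
  also have "\<dots> = potential \<tau> lam h" by (simp only: split)
  finally show ?thesis .
qed

text \<open>Age counts completed local rounds, so for \<open>\<tau> = start k c l\<close> these are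
  the active stations whose next local round lies in iteration \<open>l\<close> or later.\<close>

definition survivors :: "nat \<Rightarrow> history \<Rightarrow> nat set" where
  "survivors \<tau> h = {i \<in> active h. \<tau> \<le> age h i}"

text \<open>Each survivor has weight \<open>1\<close> and contributes the factor
  \<open>1 + lam\<close>; all other factors are at least \<open>1\<close>.\<close>

lemma potential_ge_survivors:
  assumes h: "h = R \<omega> t" and lam: "0 \<le> lam"
  shows "(1 + lam) ^ card (survivors \<tau> h) \<le> potential \<tau> lam h"
proof -
  have sub: "survivors \<tau> h \<subseteq> {..<k}"
    using active_run_subset[of k adv \<omega> t] h by (auto simp: survivors_def)
  have "(1 + lam) ^ card (survivors \<tau> h) =
      (\<Prod>i\<in>survivors \<tau> h. 1 + lam * station_weight \<tau> h i)"
    by (subst prod_constant[symmetric], intro prod.cong)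
      (auto simp: survivors_def station_weight_def active_def fail_bound_def)
  also have "\<dots> \<le> potential \<tau> lam h"
    unfolding potential_def using sub lam station_weight_nonneg by (intro prod_mono2) auto
  finally show ?thesis .
qed

text \<open>The assumption \<open>load\<close> closes the circle: as long as no threshold
  \<open>a l\<close> has been reached, the load is small and all potentials are supermartingales.
  Dividing each potential by \<open>(1 + lam l) powr a l\<close> makes their sum reach
  \<open>1\<close> as soon as a threshold is reached; the bound is the value of this sum at the
  empty history.\<close>

lemma prob_many_survivors:
  fixes L :: "'l set" and \<tau> :: "'l \<Rightarrow> nat" and lam a :: "'l \<Rightarrow> real"
  assumes L: "finite L" and lam: "\<And>l. l \<in> L \<Longrightarrow> 0 \<le> lam l"
    and load: "\<And>\<omega> t. (\<And>l. l \<in> L \<Longrightarrow> card (survivors (\<tau> l) (R \<omega> t)) < a l) \<Longrightarrow>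
      load (R \<omega> t) \<le> 2 / 3"
  shows "prob {\<omega>. \<exists>t. \<exists>l\<in>L. a l \<le> card (survivors (\<tau> l) (R \<omega> t))}
    \<le> (\<Sum>l\<in>L. (1 + lam l * fail_bound (\<tau> l) 0) ^ k / (1 + lam l) powr a l)"
proof -
  define \<Psi> where "\<Psi> h = (\<Sum>l\<in>L. potential (\<tau> l) (lam l) h / (1 + lam l) powr a l)" for h
  have term_nonneg: "0 \<le> potential (\<tau> l) (lam l) h / (1 + lam l) powr a l" if "l \<in> L" for l h
    using lam[OF that] potential_nonneg by simp
  have nonneg: "0 \<le> \<Psi> h" for h
    unfolding \<Psi>_def by (intro sum_nonneg term_nonneg)
  have many: "1 \<le> \<Psi> (R \<omega> t)" if l: "l \<in> L" "a l \<le> card (survivors (\<tau> l) (R \<omega> t))" for \<omega> t l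
  proof -
    have "(1 + lam l) powr a l \<le> (1 + lam l) powr card (survivors (\<tau> l) (R \<omega> t))"
      using lam[OF l(1)] l(2) by (intro powr_mono) auto
    also have "\<dots> = (1 + lam l) ^ card (survivors (\<tau> l) (R \<omega> t))"
      using lam[OF l(1)] by (simp add: powr_realpow)
    also have "\<dots> \<le> potential (\<tau> l) (lam l) (R \<omega> t)"
      using potential_ge_survivors lam[OF l(1)] by blast
    finally have "1 \<le> potential (\<tau> l) (lam l) (R \<omega> t) / (1 + lam l) powr a l"
      using lam[OF l(1)] by simp
    also have "\<dots> \<le> \<Psi> (R \<omega> t)"
      unfolding \<Psi>_def using L l term_nonneg by (intro member_le_sum) auto
    finally show ?thesis .
  qed
  have "prob {\<omega>. \<exists>t. \<exists>l\<in>L. a l \<le> card (survivors (\<tau> l) (R \<omega> t))}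
      \<le> prob {\<omega>\<in>space (coins p). \<exists>t. 1 \<le> \<Psi> (R \<omega> t)}"
  proof (rule finite_measure_mono)
    show "{\<omega>\<in>space (coins p). \<exists>t. 1 \<le> \<Psi> (R \<omega> t)} \<in> events" by measurable
  qed (use many in auto)
  also have "\<dots> \<le> \<Psi> []"
  proof (simp, rule maximal_inequality[OF nonneg])
    fix \<omega> t h assume h: "h = R \<omega> t" and "\<Psi> h < 1"
    \<comment> \<open>By the contrapositive of \<open>many\<close>, \<open>\<Psi> h < 1\<close>
      means that no threshold is reached at \<open>h\<close>.\<close>
    then have "load h \<le> 2 / 3"
      using load many by (metis not_le)
    let ?h' = "\<lambda>X. h @ [(new_activations k adv h, X)]"
    have "(\<Sum>X\<in>Pow (active h). step_prob h X * \<Psi> (?h' X)) =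
        (\<Sum>l\<in>L. (\<Sum>X\<in>Pow (active h). step_prob h X * potential (\<tau> l) (lam l) (?h' X)) /
          (1 + lam l) powr a l)"
      unfolding \<Psi>_def sum_distrib_left sum_divide_distrib
      by (subst sum.swap) simp
    also have "\<dots> \<le> \<Psi> h"
      unfolding \<Psi>_def using \<open>load h \<le> 2 / 3\<close> h lam
      by (intro sum_mono divide_right_mono expected_potential_step) auto
    finally show "(\<Sum>X\<in>Pow (active h). step_prob h X * \<Psi> (?h' X)) \<le> \<Psi> h" .
  qed
  also have "\<Psi> [] = (\<Sum>l\<in>L. (1 + lam l * fail_bound (\<tau> l) 0) ^ k / (1 + lam l) powr a l)"
    by (simp add: \<Psi>_def potential_def station_weight_def)
  finally show ?thesis .
qed

end

section \<open>The schedule of NonAdaptiveWithK\<close>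

lemma length_concat_replicate:
  "length (concat (map (\<lambda>l. replicate (n l) (v l)) [0..<N])) = (\<Sum>l<N. n l)"
  by (induction N) auto

lemma nth_concat_replicate:
  assumes "l < N" "(\<Sum>l'<l. n l') \<le> m" "m < (\<Sum>l'<Suc l. n l')"
  shows "concat (map (\<lambda>l. replicate (n l) (v l)) [0..<N]) ! m = v l"
  using assms(1)
proof (induction N)
  case (Suc N)
  show ?case
  proof (cases "l = N")
    case True
    then show ?thesis using assms by (simp add: nth_append length_concat_replicate)
  next
    case False
    with Suc have "l < N" by simp
    then have "(\<Sum>l'<Suc l. n l') \<le> (\<Sum>l'<N. n l')" by (intro sum_mono2) auto
    then have "m < (\<Sum>l'<N. n l')" using assms(3) by simp
    then show ?thesis
      using Suc.IH[OF \<open>l < N\<close>] by (simp add: nth_append length_concat_replicate)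
  qed
qed simp

lemma ex_block:
  fixes n :: "nat \<Rightarrow> nat"
  assumes "m < (\<Sum>l<N. n l)"
  shows "\<exists>l<N. (\<Sum>l'<l. n l') \<le> m \<and> m < (\<Sum>l'<Suc l. n l')"
  using assms
proof (induction N)
  case (Suc N)
  show ?case
  proof (cases "m < (\<Sum>l<N. n l)")
    case True
    with Suc.IH show ?thesis using less_SucI by blast
  next
    case False
    with Suc.prems show ?thesis by (intro exI[of _ N]) auto
  qed
qed simp

text \<open>The age at which a station is about to enter iteration \<open>l\<close>; for
  \<open>l = Suc (loglog k)\<close> the length of the whole schedule.\<close>

definition start :: "nat \<Rightarrow> nat \<Rightarrow> nat \<Rightarrow> nat" where
  "start k c l = (\<Sum>l'<l. c * phi k l')"

lemma start_0 [simp]: "start k c 0 = 0"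
  by (simp add: start_def)

lemma start_Suc: "start k c (Suc l) = start k c l + c * phi k l"
  by (simp add: start_def)

lemma length_schedule: "length (schedule k c) = start k c (Suc (loglog k))"
  by (simp add: schedule_def start_def length_concat_replicate del: upt_Suc)

lemma NonAdaptiveWithK_block:
  assumes "l \<le> loglog k" "start k c l \<le> m" "m < start k c (Suc l)"
  shows "NonAdaptiveWithK k c (Suc m) = 2 ^ l / (2 * real k)"
proof -
  have "start k c (Suc l) \<le> start k c (Suc (loglog k))"
    unfolding start_def using assms(1) by (intro sum_mono2) auto
  then have "m < length (schedule k c)" using assms(3) by (simp add: length_schedule)
  then show ?thesis
    using assms nth_concat_replicate[of l "Suc (loglog k)" "\<lambda>l. c * phi k l" m]
    by (simp add: NonAdaptiveWithK_def schedule_def start_def del: upt_Suc)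
qed

text \<open>Summing over all iterations begun so far, instead of singling out the current one, lets
  the load be expressed through the numbers of survivors by exchanging sums.\<close>

lemma NonAdaptiveWithK_le:
  "NonAdaptiveWithK k c (Suc m) \<le> (\<Sum>l\<le>loglog k. if start k c l \<le> m then 2 ^ l / (2 * real k) else 0)"
    (is "_ \<le> sum ?f _")
proof (cases "m < start k c (Suc (loglog k))")
  case True
  then obtain l where l: "l \<le> loglog k" "start k c l \<le> m" "m < start k c (Suc l)"
    using ex_block[of m "\<lambda>l. c * phi k l" "Suc (loglog k)"] unfolding start_def
    by (auto simp: less_Suc_eq_le)
  then have "NonAdaptiveWithK k c (Suc m) = ?f l" by (simp add: NonAdaptiveWithK_block)
  also have "\<dots> \<le> sum ?f {..loglog k}" using l by (intro member_le_sum) auto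
  finally show ?thesis .
next
  case False
  then show ?thesis by (auto simp: NonAdaptiveWithK_def length_schedule intro!: sum_nonneg)
qed

lemma sum_NonAdaptiveWithK:
  "l \<le> Suc (loglog k) \<Longrightarrow>
    (\<Sum>m<start k c l. NonAdaptiveWithK k c (Suc m)) = (\<Sum>l'<l. real (c * phi k l') * (2 ^ l' / (2 * real k)))"
proof (induction l)
  case (Suc l)
  let ?p = "\<lambda>m. NonAdaptiveWithK k c (Suc m)"
  have "(\<Sum>m<start k c (Suc l). ?p m) =
      (\<Sum>m<start k c l. ?p m) + (\<Sum>m\<in>{start k c l..<start k c (Suc l)}. ?p m)"
    unfolding lessThan_atLeast0 by (rule sum.atLeastLessThan_concat[symmetric]) (auto simp: start_Suc)
  also have "(\<Sum>m\<in>{start k c l..<start k c (Suc l)}. ?p m) =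
      (\<Sum>m\<in>{start k c l..<start k c (Suc l)}. 2 ^ l / (2 * real k))"
    using Suc.prems by (intro sum.cong refl NonAdaptiveWithK_block) auto
  also have "\<dots> = real (c * phi k l) * (2 ^ l / (2 * real k))"
    by (simp add: start_Suc)
  finally show ?case using Suc by simp
qed simp

lemma phi_ge: "l < loglog k \<Longrightarrow> real k / 2 ^ l \<le> real (phi k l)"
  unfolding phi_def by (simp add: real_nat_ceiling_ge)

lemma phi_loglog [simp]: "phi k (loglog k) = k"
  by (simp add: phi_def)

section \<open>Estimates for a fixed number of stations\<close>

context
  fixes k :: nat
  assumes k: "2 \<le> k"
begin

lemma log2_bounds: "1 \<le> log 2 (real k)" "log 2 (real k) \<le> 2 * ln (real k)" "ln (real k) \<le> log 2 (real k)"
proof -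
  show "1 \<le> log 2 (real k)" using k by (simp add: le_log_iff)
  \<comment> \<open>Both bounds come from ln x \<le> x - 1, at x = 1/2 and x = 2.\<close>
  have ln2: "1 / 2 \<le> ln (2::real)" "ln (2::real) \<le> 1"
    using ln_le_minus_one[of "1 / 2 :: real"] ln_le_minus_one[of "2 :: real"] by (auto simp: ln_div)
  have ln: "0 \<le> ln (real k)" using k by simp
  have "ln (real k) * 1 \<le> ln (real k) * (2 * ln 2)" using ln ln2 by (intro mult_left_mono) auto
  then show "log 2 (real k) \<le> 2 * ln (real k)" using ln2 by (simp add: log_def field_simps)
  have "ln (real k) * ln 2 \<le> ln (real k) * 1" using ln ln2 by (intro mult_left_mono) auto
  then show "ln (real k) \<le> log 2 (real k)" using ln2 by (simp add: log_def field_simps)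
qed

lemma loglog_bounds:
  "log 2 (real k) \<le> 2 ^ loglog k" "2 ^ loglog k \<le> 2 * log 2 (real k)" "loglog k \<le> k"
proof -
  have y: "1 \<le> log 2 (real k)" by (rule log2_bounds)
  have nonneg: "0 \<le> log 2 (log 2 (real k))" using y by (subst zero_le_log_cancel_iff) auto
  have "log 2 (log 2 (real k)) \<le> real (loglog k)"
    unfolding loglog_def by (rule real_nat_ceiling_ge)
  then have "2 powr log 2 (log 2 (real k)) \<le> 2 powr real (loglog k)" by simp
  then show "log 2 (real k) \<le> 2 ^ loglog k" using y by (simp add: powr_realpow)
  have "real (loglog k) \<le> log 2 (log 2 (real k)) + 1"
    using nonneg unfolding loglog_def by linarith
  then have "2 powr real (loglog k) \<le> 2 powr (log 2 (log 2 (real k)) + 1)" by simp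
  also have "\<dots> = 2 * log 2 (real k)" using y by (simp add: powr_add)
  finally show "2 ^ loglog k \<le> 2 * log 2 (real k)" by (simp add: powr_realpow)
  have k_bound: "log 2 (real k) \<le> real k"
    using k log2_of_power_le[of k k] less_exp[of k] by simp
  then have "log 2 (log 2 (real k)) \<le> log 2 (real k)" using y k by (subst log_le_cancel_iff) auto
  then have "log 2 (log 2 (real k)) \<le> real k" using k_bound by simp
  then show "loglog k \<le> k"
    unfolding loglog_def by (simp add: nat_le_iff ceiling_le_iff)
qed

text \<open>Before rounding, the lengths \<open>k / 2 ^ l\<close> sum to at most
  \<open>2 * k\<close>; rounding up costs at most \<open>loglog k \<le> k\<close>, and the last
  iteration adds \<open>k\<close>.\<close>

lemma start_le: "real (start k c (Suc (loglog k))) \<le> 4 * real c * real k"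
proof -
  have phi: "real (phi k l) \<le> real k * (1 / 2) ^ l + 1" if "l < loglog k" for l
  proof -
    have "real (nat \<lceil>real k / 2 ^ l\<rceil>) \<le> real k / 2 ^ l + 1"
      using of_int_ceiling_le_add_one[of "real k / 2 ^ l"] by simp
    then show ?thesis using that by (simp add: phi_def power_divide)
  qed
  have "(\<Sum>l<loglog k. real (phi k l)) \<le> (\<Sum>l<loglog k. real k * (1 / 2) ^ l + 1)"
    using phi by (intro sum_mono) auto
  also have "\<dots> = real k * (\<Sum>l<loglog k. (1 / 2) ^ l) + real (loglog k)"
    by (simp add: sum.distrib sum_distrib_left)
  also have "(\<Sum>l<loglog k. (1 / 2 :: real) ^ l) \<le> 2"
    by (simp add: sum_gp_strict)
  finally have "(\<Sum>l<loglog k. real (phi k l)) \<le> 3 * real k"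
    using loglog_bounds(3) by (simp add: mult_left_mono)
  then have "real c * ((\<Sum>l<loglog k. real (phi k l)) + real k) \<le> real c * (4 * real k)"
    by (intro mult_left_mono) auto
  then show ?thesis
    by (simp add: start_def sum_distrib_left distrib_left)
qed

text \<open>With x = ln k, \<open>8 ^ l\<close> is at most \<open>(4 * x) ^ 3\<close>, while
  \<open>k = exp x\<close> is at least the single term \<open>x ^ 4 / 24\<close> of the exponential
  series; 1536 is 64 times 24. Thus every threshold is at least a multiple of ln k, and a bound
  exponential in it is polynomial in \<open>k\<close>.\<close>

lemma ln_le_level: "l \<le> loglog k \<Longrightarrow> ln (real k) / 1536 \<le> real k / 8 ^ l"
proof -
  assume l: "l \<le> loglog k"
  let ?x = "ln (real k)"
  have x: "0 < ?x" using k by simp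
  have "?x ^ 4 / fact 4 \<le> exp ?x" 
  proof -
    have "(\<Sum>n\<in>{4}. ?x ^ n /\<^sub>R fact n) \<le> (\<Sum>n. ?x ^ n /\<^sub>R fact n)"
      using x by (intro sum_le_suminf summable_exp_generic) auto
    then show ?thesis by (simp add: exp_def field_simps)
  qed
  then have k_ge: "?x ^ 4 / 24 \<le> real k" using k by (simp add: fact_numeral)
  have "(8::real) ^ l \<le> 8 ^ loglog k" using l by (intro power_increasing) auto
  also have "\<dots> = (2 ^ loglog k) ^ 3" by (simp add: power3_eq_cube flip: power_mult_distrib)
  also have "\<dots> \<le> (4 * ?x) ^ 3"
    using loglog_bounds(2) log2_bounds(2) by (intro power_mono) auto
  finally have "8 ^ l \<le> 64 * ?x ^ 3" by (simp add: power_mult_distrib)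
  then have "?x / 1536 * 8 ^ l \<le> ?x / 1536 * (64 * ?x ^ 3)"
    using x by (intro mult_left_mono) auto
  also have "\<dots> = ?x ^ 4 / 24" by (simp add: power_numeral_reduce)
  finally have "?x / 1536 * 8 ^ l \<le> real k" using k_ge by simp
  then show ?thesis by (simp add: field_simps)
qed

lemma channel_NonAdaptiveWithK: "channel (NonAdaptiveWithK k c)"
  using NonAdaptiveWithK_bounds[OF k] by unfold_locales auto

text \<open>The index \<open>Suc (loglog k)\<close> stands for the end of the schedule, where a
  single survivor is already bad.\<close>

abbreviation (input) survivor_limit :: "nat \<Rightarrow> real" where
  "survivor_limit l \<equiv> if l \<le> loglog k then real k / 8 ^ l else 1"

text \<open>Level \<open>l\<close> contributes at most
  \<open>k / 8 ^ l * (2 ^ l / (2 * k)) = (1 / 4) ^ l / 2\<close>, and the geometric series sums to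
  \<open>2 / 3\<close>. Level \<open>0\<close> is bounded by the total number \<open>k\<close> of
  stations.\<close>

lemma load_le_if_few_survivors:
  fixes c adv \<omega> t
  defines "h \<equiv> run k adv \<omega> t" and "p \<equiv> NonAdaptiveWithK k c"
  assumes few: "\<And>l. l \<in> {1..Suc (loglog k)} \<Longrightarrow>
      card (channel.survivors (start k c l) h) < survivor_limit l"
  shows "channel.load p h \<le> 2 / 3"
proof -
  interpret channel k p adv unfolding p_def by (rule channel_NonAdaptiveWithK)
  let ?v = "\<lambda>l. 2 ^ l / (2 * real k)"
  have fin: "finite (active h)" by (simp add: h_def)
  have card_le: "real (card (survivors (start k c l) h)) \<le> real k / 8 ^ l" if "l \<le> loglog k" for l
  proof (cases "l = 0")
    case True
    have "card (survivors (start k c l) h) \<le> card {..<k}"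
      using active_run_subset[of k adv \<omega> t]
      by (intro card_mono) (auto simp: survivors_def h_def)
    then show ?thesis using True by simp
  next
    case False
    then show ?thesis using few[of l] that by simp
  qed
  have "load h \<le> (\<Sum>i\<in>active h. \<Sum>l\<le>loglog k. if start k c l \<le> age h i then ?v l else 0)"
    unfolding load_def unfolding p_def by (intro sum_mono NonAdaptiveWithK_le)
  also have "\<dots> = (\<Sum>l\<le>loglog k. \<Sum>i\<in>active h. if start k c l \<le> age h i then ?v l else 0)"
    by (rule sum.swap)
  also have "\<dots> = (\<Sum>l\<le>loglog k. real (card (survivors (start k c l) h)) * ?v l)"
    using fin by (simp add: sum.If_cases survivors_def Int_def)
  also have "\<dots> \<le> (\<Sum>l\<le>loglog k. real k / 8 ^ l * ?v l)"
    using card_le by (intro sum_mono mult_right_mono) auto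
  also have "\<dots> = (\<Sum>l\<le>loglog k. (1 / 4) ^ l / 2)"
  proof (intro sum.cong refl)
    fix l
    have "(8::real) ^ l = 4 ^ l * 2 ^ l" by (simp flip: power_mult_distrib)
    then show "real k / 8 ^ l * ?v l = (1 / 4) ^ l / 2" using k by (simp add: field_simps)
  qed
  also have "\<dots> = 2 / 3 - (1 / 4) ^ loglog k / 6"
  proof -
    have "(\<Sum>l\<le>n. (1 / 4) ^ l / 2) = 2 / 3 - (1 / 4 :: real) ^ n / 6" for n
      by (induction n) auto
    then show ?thesis .
  qed
  also have "\<dots> \<le> 2 / 3" by simp
  finally show ?thesis .
qed

text \<open>By 1 - x \<le> exp (-x), only the sum of the transmission probabilities matters. Each
  iteration before the last adds at least \<open>c / 2\<close> to it, and the last one, with its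
  \<open>c * k\<close> rounds, at least \<open>c * ln k / 2\<close>.\<close>

lemma fail_bound_start:
  fixes c :: nat
  defines "p \<equiv> NonAdaptiveWithK k c"
  shows "l \<le> loglog k \<Longrightarrow> channel.fail_bound p (start k c l) 0 \<le> exp (- (real c * real l / 6))"
    and "channel.fail_bound p (start k c (Suc (loglog k))) 0 \<le> real k powr (- (real c / 6))"
proof -
  \<comment> \<open>A dummy adversary to instantiate the locale; \<open>fail_bound\<close> is a
    function of \<open>p\<close> alone.\<close>
  interpret channel k p "\<lambda>_. {}" unfolding p_def by (rule channel_NonAdaptiveWithK)
  let ?s = "\<lambda>l. \<Sum>l'<l. real (c * phi k l') * (2 ^ l' / (2 * real k))"
  have bound: "fail_bound (start k c l) 0 \<le> exp (- (?s l / 3))" if "l \<le> Suc (loglog k)" for l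
  proof -
    have "fail_bound (start k c l) 0 = (\<Prod>m<start k c l. 1 - p (Suc m) / 3)"
    proof -
      have "{0<..start k c l} = Suc ` {..<start k c l}"
        by (auto simp: image_Suc_lessThan)
      then show ?thesis by (simp add: fail_bound_def prod.reindex)
    qed
    also have "\<dots> \<le> (\<Prod>m<start k c l. exp (- (p (Suc m) / 3)))"
    proof (intro prod_mono conjI)
      fix m
      show "0 \<le> 1 - p (Suc m) / 3" using p_le_1[of "Suc m"] by simp
      show "1 - p (Suc m) / 3 \<le> exp (- (p (Suc m) / 3))"
        using exp_ge_add_one_self[of "- (p (Suc m) / 3)"] by simp
    qed
    also have "\<dots> = exp (- (\<Sum>m<start k c l. p (Suc m)) / 3)"
      by (simp add: exp_sum[symmetric] sum_negf sum_divide_distrib)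
    also have "(\<Sum>m<start k c l. p (Suc m)) = ?s l"
      unfolding p_def using that by (rule sum_NonAdaptiveWithK)
    finally show ?thesis by simp
  qed
  have s: "real c * real l / 2 \<le> ?s l" if "l \<le> loglog k" for l
  proof -
    have "(\<Sum>l'<l. real c / 2) \<le> ?s l"
    proof (intro sum_mono)
      fix l' assume "l' \<in> {..<l}"
      then have "real k / 2 ^ l' \<le> real (phi k l')" using that by (intro phi_ge) auto
      then have "real c * (real k / 2 ^ l') * (2 ^ l' / (2 * real k)) \<le>
          real c * real (phi k l') * (2 ^ l' / (2 * real k))"
        by (intro mult_right_mono mult_left_mono) auto
      then show "real c / 2 \<le> real (c * phi k l') * (2 ^ l' / (2 * real k))"
        using k by simp
    qed
    then show ?thesis by (simp add: mult.commute)
  qed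
  show "fail_bound (start k c l) 0 \<le> exp (- (real c * real l / 6))" if "l \<le> loglog k"
    using bound[of l] s[OF that] that by (auto intro: order_trans)
  have "real c * ln (real k) \<le> real c * 2 ^ loglog k"
    using log2_bounds loglog_bounds by (intro mult_left_mono) auto
  also have "\<dots> / 2 \<le> ?s (Suc (loglog k))"
    using k by (simp add: sum_nonneg)
  finally have "real c * ln (real k) / 2 \<le> ?s (Suc (loglog k))" by simp
  then have "exp (- (?s (Suc (loglog k)) / 3)) \<le> exp (- (real c / 6) * ln (real k))" by simp
  also have "\<dots> = real k powr (- (real c / 6))" using k by (simp add: powr_def)
  finally show "fail_bound (start k c (Suc (loglog k))) 0 \<le> real k powr (- (real c / 6))"
    using bound[of "Suc (loglog k)"] by simp
qed

lemma one_plus_power_le_exp: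
  fixes x :: real
  assumes "0 \<le> x"
  shows "(1 + x) ^ n \<le> exp (real n * x)"
proof -
  have "(1 + x) ^ n \<le> exp x ^ n"
    using assms exp_ge_add_one_self[of x] by (intro power_mono) auto
  then show ?thesis by (simp add: exp_of_nat_mult)
qed

text \<open>For \<open>1 \<le> l \<le> loglog k\<close> the weight times \<open>fail_bound\<close>
  is at most \<open>exp (- (c / 12)) ^ l\<close>, so the initial potential is at most
  \<open>exp (k / 8 ^ l)\<close> once \<open>c \<ge> 36\<close>, against the divisor
  \<open>exp (c / 12)\<close> to the power \<open>k / 8 ^ l\<close>. The last weight makes
  \<open>k\<close> times weight times \<open>fail_bound\<close> at most \<open>1\<close>.\<close>

abbreviation (input) level_weight :: "nat \<Rightarrow> nat \<Rightarrow> real" where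
  "level_weight c l \<equiv> (if l \<le> loglog k then exp (real c / 12) - 1 else real k powr (real c / 6 - 1))"

text \<open>There are at most \<open>k\<close> early levels, each contributing at most
  \<open>exp (- (c / 12 - 1) * (k / 8 ^ l))\<close>, which \<open>ln_le_level\<close> turns into a
  power of \<open>k\<close>. The last level has initial potential at most
  \<open>exp 1 \<le> k powr 2\<close>, divided by more than
  \<open>k powr (c / 6 - 1)\<close>.\<close>

lemma initial_potential_le:
  fixes c :: nat
  assumes c: "36 \<le> c"
  defines "p \<equiv> NonAdaptiveWithK k c"
  shows "(\<Sum>l\<in>{1..Suc (loglog k)}. (1 + level_weight c l * channel.fail_bound p (start k c l) 0) ^ k /
      (1 + level_weight c l) powr survivor_limit l)
    \<le> real k powr (1 - (real c / 12 - 1) / 1536) + real k powr (3 - real c / 6)"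
proof -
  interpret channel k p "\<lambda>_. {}" unfolding p_def by (rule channel_NonAdaptiveWithK)
  let ?g = "\<lambda>l. fail_bound (start k c l) 0"
  let ?T = "\<lambda>l. (1 + level_weight c l * ?g l) ^ k / (1 + level_weight c l) powr survivor_limit l"
  let ?b = "(real c / 12 - 1) / 1536"
  have c_pos: "0 \<le> real c / 12 - 1" using c by simp
  have early: "?T l \<le> real k powr (- ?b)" if l: "l \<in> {1..loglog k}" for l
  proof -
    define a where "a = real k / 8 ^ l"
    let ?lam = "exp (real c / 12) - 1"
    have lam: "0 \<le> ?lam" by simp
    have "exp (- (real c / 12)) \<le> exp (- 3)" using c by simp
    also have "\<dots> = 1 / exp 1 ^ 3" by (simp add: exp_minus inverse_eq_divide flip: exp_of_nat_mult)
    also have "\<dots> \<le> 1 / 2 ^ 3"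
      using exp_ge_add_one_self[of 1] by (intro divide_left_mono power_mono) auto
    finally have e8: "exp (- (real c / 12)) \<le> 1 / 8" by simp
    have "?lam * ?g l \<le> exp (real c / 12) * exp (- (real c * real l / 6))"
      using fail_bound_start(1)[of l c] l fail_bound_nonneg unfolding p_def by (intro mult_mono) auto
    also have "\<dots> = exp (real c / 12 - real c * real l / 6)" by (simp flip: exp_add)
    also have "\<dots> \<le> exp (- (real c / 12)) ^ l"
    proof -
      \<comment> \<open>As \<open>l \<ge> 1\<close>, half of the exponent \<open>c * l / 6\<close>
        absorbs the weight \<open>exp (c / 12)\<close>.\<close>
      have "real c * 1 \<le> real c * real l" using l by (intro mult_left_mono) auto
      then show ?thesis by (simp flip: exp_of_nat_mult) (simp add: field_simps)
    qed
    also have "\<dots> \<le> (1 / 8) ^ l" using e8 by (intro power_mono) auto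
    finally have "real k * (?lam * ?g l) \<le> real k * (1 / 8) ^ l" by (intro mult_left_mono) auto
    then have "real k * (?lam * ?g l) \<le> a" by (simp add: a_def power_divide)
    then have "(1 + ?lam * ?g l) ^ k \<le> exp a"
      using one_plus_power_le_exp[of "?lam * ?g l" k] lam fail_bound_nonneg
      by (meson exp_le_cancel_iff mult_nonneg_nonneg order_trans)
    then have "?T l \<le> exp a / exp (real c / 12) powr a"
      using l by (simp add: a_def divide_right_mono)
    also have "\<dots> = exp (- ((real c / 12 - 1) * a))"
      by (simp add: powr_def algebra_simps flip: exp_diff)
    also have "\<dots> \<le> exp (- ((real c / 12 - 1) * (ln (real k) / 1536)))"
      using mult_left_mono[OF ln_le_level[of l] c_pos] l
      unfolding exp_le_cancel_iff neg_le_iff_le a_def by auto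
    also have "\<dots> = real k powr (- ?b)" using k by (simp add: powr_def)
    finally show ?thesis .
  qed
  have last: "?T (Suc (loglog k)) \<le> real k powr (3 - real c / 6)"
  proof -
    let ?l = "Suc (loglog k)" and ?lam = "real k powr (real c / 6 - 1)"
    have "real k * (?lam * ?g ?l) \<le> real k * (?lam * real k powr (- (real c / 6)))"
      using fail_bound_start(2)[of c] unfolding p_def by (intro mult_left_mono) auto
    also have "\<dots> = real k powr 1 * (?lam * real k powr (- (real c / 6)))" using k by simp
    also have "\<dots> = 1" using k by (simp only: powr_add[symmetric]) simp
    finally have "(1 + ?lam * ?g ?l) ^ k \<le> exp 1"
      using one_plus_power_le_exp[of "?lam * ?g ?l" k] fail_bound_nonneg
      by (meson exp_le_cancel_iff mult_nonneg_nonneg order_trans powr_ge_zero)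
    also have "\<dots> \<le> 4" using exp_le by simp
    also have "\<dots> \<le> real k powr 2"
      using k power_mono[of 2 "real k" 2] by (simp add: powr_realpow[of _ 2, simplified])
    finally have "?T ?l \<le> real k powr 2 / ?lam"
      by (simp add: frac_le add_pos_pos k[THEN order_less_le_trans[rotated]])
    also have "\<dots> = real k powr (3 - real c / 6)" by (simp only: powr_diff[symmetric]) simp
    finally show ?thesis .
  qed
  have "(\<Sum>l\<in>{1..loglog k}. ?T l) \<le> (\<Sum>l\<in>{1..loglog k}. real k powr (- ?b))"
    by (intro sum_mono early)
  also have "\<dots> \<le> real k * real k powr (- ?b)"
    unfolding sum_constant using loglog_bounds(3) by (intro mult_right_mono) auto
  also have "\<dots> = real k powr (1 - ?b)"
    using k powr_add[of "real k" 1 "- ?b"] by simp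
  finally have sum_early: "(\<Sum>l\<in>{1..loglog k}. ?T l) \<le> real k powr (1 - ?b)" .
  have split: "(\<Sum>l\<in>{1..Suc (loglog k)}. ?T l) = (\<Sum>l\<in>{1..loglog k}. ?T l) + ?T (Suc (loglog k))"
    by (subst sum.nat_ivl_Suc', simp, rule add.commute)
  show ?thesis
    unfolding split using sum_early last by (rule add_mono)
qed

end

theorem theorem3p1:
  "\<exists>C :: nat \<Rightarrow> real. \<forall>\<eta>::real. \<eta> > 0 \<longrightarrow> (\<exists>c0::nat. \<forall>c\<ge>c0. \<forall>k\<ge>2. \<forall>adv.
     activates_all k (NonAdaptiveWithK k c) adv \<longrightarrow>
     measure (coins (NonAdaptiveWithK k c))
       {\<omega> \<in> space (coins (NonAdaptiveWithK k c)). \<forall>i<k. \<exists>t s.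
          activation k adv \<omega> i t \<and> success k adv \<omega> i s \<and>
          t < s \<and> real s \<le> real t + C c * real k}
     \<ge> 1 - 1 / real k powr \<eta>)"
\<comment> \<open>The factor \<open>4 * c\<close> is the bound of \<open>start_le\<close> on the
  length of the schedule.\<close>
proof (intro exI[of _ "\<lambda>c. 4 * real c"] allI impI)
  fix \<eta> :: real assume \<eta>: "\<eta> > 0"
  show "\<exists>c0::nat. \<forall>c\<ge>c0. \<forall>k\<ge>2. \<forall>adv.
     activates_all k (NonAdaptiveWithK k c) adv \<longrightarrow>
     measure (coins (NonAdaptiveWithK k c))
       {\<omega> \<in> space (coins (NonAdaptiveWithK k c)). \<forall>i<k. \<exists>t s.
          activation k adv \<omega> i t \<and> success k adv \<omega> i s \<and>
          t < s \<and> real s \<le> real t + 4 * real c * real k}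
     \<ge> 1 - 1 / real k powr \<eta>"
  proof (intro exI[of _ "nat \<lceil>18432 * \<eta> + 36876\<rceil>"] allI impI)
    fix c k adv
    assume c0: "nat \<lceil>18432 * \<eta> + 36876\<rceil> \<le> c" and k: "2 \<le> (k::nat)"
      and act: "activates_all k (NonAdaptiveWithK k c) adv"
    \<comment> \<open>that is, \<open>(c / 12 - 1) / 1536 \<ge> \<eta> + 2\<close>\<close>
    have c: "18432 * \<eta> + 36876 \<le> real c"
      using c0 real_nat_ceiling_ge[of "18432 * \<eta> + 36876"] by linarith
    define p where "p = NonAdaptiveWithK k c"
    interpret channel k p adv unfolding p_def by (rule channel_NonAdaptiveWithK[OF k])
    let ?S = "start k c (Suc (loglog k))" and ?L = "{1..Suc (loglog k)}"
    let ?lam = "\<lambda>l. if l \<le> loglog k then exp (real c / 12) - 1 else real k powr (real c / 6 - 1)"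
    let ?a = "\<lambda>l. if l \<le> loglog k then real k / 8 ^ l else 1"
    define Good where "Good = {\<omega> \<in> space (coins p). \<forall>i<k. \<exists>t s.
          activation k adv \<omega> i t \<and> success k adv \<omega> i s \<and>
          t < s \<and> real s \<le> real t + 4 * real c * real k}"
    define Bad where "Bad = {\<omega> \<in> space (coins p). \<exists>t. \<exists>l\<in>?L. ?a l \<le> card (survivors (start k c l) (R \<omega> t))}"
    have Good: "Good \<in> events"
      unfolding Good_def activation_def success_def by measurable
    have Bad: "Bad \<in> events" unfolding Bad_def by measurable
    have "prob Bad = prob {\<omega>. \<exists>t. \<exists>l\<in>?L. ?a l \<le> card (survivors (start k c l) (R \<omega> t))}"
      by (simp add: Bad_def)
    also have "\<dots> \<le>
        (\<Sum>l\<in>?L. (1 + ?lam l * fail_bound (start k c l) 0) ^ k / (1 + ?lam l) powr ?a l)"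
    proof (rule prob_many_survivors)
      show "load (R \<omega> t) \<le> 2 / 3"
        if "\<And>l. l \<in> ?L \<Longrightarrow> card (survivors (start k c l) (R \<omega> t)) < ?a l" for \<omega> t
        using load_le_if_few_survivors[OF k, of c adv \<omega> t] that unfolding p_def .
    qed auto
    also have "\<dots> \<le> real k powr (1 - (real c / 12 - 1) / 1536) + real k powr (3 - real c / 6)"
    proof -
      have "36 \<le> real c" using c \<eta> by linarith
      then show ?thesis unfolding p_def by (intro initial_potential_le k) simp
    qed
    \<comment> \<open>The choice of \<open>c\<close> turns the first exponent into at most
      \<open>1 - (\<eta> + 2)\<close>, and the second is smaller still. The spare factor
      \<open>1 / k\<close> then absorbs the two summands because \<open>k \<ge> 2\<close>.\<close>
    also have "\<dots> \<le> real k powr (- \<eta> - 1) + real k powr (- \<eta> - 1)"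
      using c \<eta> k by (intro add_mono powr_mono) (auto simp: field_simps)
    also have "\<dots> = 2 / real k * real k powr (- \<eta>)"
      using k by (simp add: powr_diff)
    also have "\<dots> \<le> 1 * real k powr (- \<eta>)"
      using k by (intro mult_right_mono) auto
    finally have prob_Bad: "prob Bad \<le> 1 / real k powr \<eta>"
      by (simp add: powr_minus_divide)
    have good: "\<omega> \<in> Good" if not_bad: "\<omega> \<notin> Bad" and act: "\<forall>i<k. \<exists>t. activation k adv \<omega> i t" for \<omega>
    proof -
      have "\<exists>t s. activation k adv \<omega> i t \<and> success k adv \<omega> i s \<and>
          t < s \<and> real s \<le> real t + 4 * real c * real k" if i: "i < k" for i
      proof -
        obtain t where t: "activation k adv \<omega> i t" using act i by blast
        \<comment> \<open>After \<open>n\<close> rounds station \<open>i\<close> has completed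
          exactly the \<open>?S\<close> local rounds of the schedule; the \<open>Suc\<close>
          accounts for the activation round, which is local round \<open>0\<close>.\<close>
        define n where "n = Suc (t + ?S)"
        let ?h = "R \<omega> n"
        have "Suc t \<le> n" by (simp add: n_def)
        then have ht: "activated_in ?h i t"
          using t unfolding activation_def by (rule activated_in_run_mono)
        have age: "age ?h i = ?S" using Suc_age_run[OF ht] by (simp add: n_def)
        have "survivors ?S ?h = {}"
        proof -
          have "\<not> ?a (Suc (loglog k)) \<le> card (survivors ?S ?h)"
          proof
            assume "?a (Suc (loglog k)) \<le> card (survivors ?S ?h)"
            then have "\<exists>l\<in>?L. ?a l \<le> card (survivors (start k c l) ?h)"
              by (rule bexI) simp
            then have "\<exists>t. \<exists>l\<in>?L. ?a l \<le> card (survivors (start k c l) (R \<omega> t))"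
              by (rule exI)
            then show False
              using not_bad unfolding Bad_def space_coins by (simp only: mem_Collect_eq UNIV_I simp_thms)
          qed
          then have "card (survivors ?S ?h) = 0" by simp
          moreover have "finite (survivors ?S ?h)"
            by (rule finite_subset[OF _ finite_active_run[of k adv \<omega> n]]) (auto simp: survivors_def)
          ultimately show ?thesis by (simp only: card_0_eq)
        qed
        then have "succeeded ?h i"
          using age ht unfolding survivors_def active_def activated_def by auto
        then obtain s where s: "successful_in ?h i s" by (auto simp: succeeded_def)
        \<comment> \<open>A success comes after an activation, and a station is activated only once,
          so \<open>r = t\<close>.\<close>
        then obtain r where "r < s" "activated_in ?h i r"
          using successful_in_run_activated by blast
        then have "t < s" using activated_in_run_unique ht by blast
        moreover have "success k adv \<omega> i s"
          unfolding success_def using s by (rule successful_in_run_Suc)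
        moreover have "s \<le> t + ?S" using s unfolding successful_in_def by (simp add: n_def)
        then have "real s \<le> real t + 4 * real c * real k"
          using start_le[OF k, of c] by linarith
        ultimately show ?thesis using t by blast
      qed
      then show ?thesis by (simp add: Good_def)
    qed
    have "1 - 1 / real k powr \<eta> \<le> 1 - prob Bad" using prob_Bad by simp
    also have "\<dots> = prob (space (coins p) - Bad)" using Bad by (simp only: prob_compl)
    also have "\<dots> \<le> prob Good"
    proof (rule finite_measure_mono_AE)
      \<comment> \<open>\<open>activates_all\<close> holds only almost surely, so the complement of
        \<open>Bad\<close> lies in \<open>Good\<close> up to a null set.\<close>
      show "AE \<omega> in coins p. \<omega> \<in> space (coins p) - Bad \<longrightarrow> \<omega> \<in> Good"
        using act unfolding activates_all_def p_def[symmetric]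
        by (rule AE_mp) (use good in auto)
    qed (rule Good)
    finally show "measure (coins (NonAdaptiveWithK k c))
       {\<omega> \<in> space (coins (NonAdaptiveWithK k c)). \<forall>i<k. \<exists>t s.
          activation k adv \<omega> i t \<and> success k adv \<omega> i s \<and>
          t < s \<and> real s \<le> real t + 4 * real c * real k}
     \<ge> 1 - 1 / real k powr \<eta>"
      unfolding Good_def p_def .
  qed
qed

end
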